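(* Let $G$ be a countably infinite discrete group and let $X$ be a Borel $G$-space. If there is a locally weakly wandering Borel complete section for $X$, then $X$ admits a Borel $4$-generator.
   Context: A Borel $G$-space is a standard Borel space $X$ equipped with a Borel action of $G$; $[x]_G$ denotes the orbit of $x$. A complete section is a subset of $X$ meeting every orbit. A set $A\subseteq X$ is weakly wandering if there is an infinite $H\subseteq G$ such that $hA\cap h'A=\emptyset$ for all distinct $h,h'\in H$; it is locally weakly wandering if for every $x\in X$ the set $A\cap[x]_G$ is weakly wandering. A $k$-generator for $X$ is a partition $\{A_n\}_{n<k}$ of $X$ into Borel sets (pieces may be empty) such that $\{gA_n : g\in G, n<k\}$ generates the Borel $\sigma$-algebra of $X$. *)

theory Defs
  imports "HOL-Analysis.Analysis" "HOL-Algebra.Group_Action"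
begin

text \<open>A \<open>'a measure\<close> is used here only as a measurable space; its measure plays no role.\<close>

definition standard_borel :: "'a measure \<Rightarrow> bool"
  where "standard_borel M \<longleftrightarrow>
    (\<exists>T. completely_metrizable_space T \<and> second_countable T \<and> topspace T = space M \<and>
         sets M = sigma_sets (space M) {U. openin T U})"

text \<open>The acting group is discrete, so its Borel \<open>\<sigma>\<close>-algebra is the power set of its carrier.\<close>

definition borel_G_space ::
    "('g, 'b) monoid_scheme \<Rightarrow> 'a measure \<Rightarrow> ('g \<Rightarrow> 'a \<Rightarrow> 'a) \<Rightarrow> bool"
  where "borel_G_space G M \<phi> \<longleftrightarrow>
    standard_borel M \<and> group_action G (space M) \<phi> \<and>
    (\<lambda>(g, x). \<phi> g x) \<in> count_space (carrier G) \<Otimes>\<^sub>M M \<rightarrow>\<^sub>M M"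

definition complete_section ::
    "('g, 'b) monoid_scheme \<Rightarrow> 'a measure \<Rightarrow> ('g \<Rightarrow> 'a \<Rightarrow> 'a) \<Rightarrow> 'a set \<Rightarrow> bool"
  where "complete_section G M \<phi> A \<longleftrightarrow>
    A \<subseteq> space M \<and> (\<forall>x\<in>space M. A \<inter> orbit G \<phi> x \<noteq> {})"

definition weakly_wandering ::
    "('g, 'b) monoid_scheme \<Rightarrow> 'a measure \<Rightarrow> ('g \<Rightarrow> 'a \<Rightarrow> 'a) \<Rightarrow> 'a set \<Rightarrow> bool"
  where "weakly_wandering G M \<phi> A \<longleftrightarrow>
    A \<subseteq> space M \<and>
    (\<exists>H. H \<subseteq> carrier G \<and> infinite H \<and>
      (\<forall>h\<in>H. \<forall>h'\<in>H. h \<noteq> h' \<longrightarrow> \<phi> h ` A \<inter> \<phi> h' ` A = {}))"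

definition locally_weakly_wandering ::
    "('g, 'b) monoid_scheme \<Rightarrow> 'a measure \<Rightarrow> ('g \<Rightarrow> 'a \<Rightarrow> 'a) \<Rightarrow> 'a set \<Rightarrow> bool"
  where "locally_weakly_wandering G M \<phi> A \<longleftrightarrow>
    A \<subseteq> space M \<and> (\<forall>x\<in>space M. weakly_wandering G M \<phi> (A \<inter> orbit G \<phi> x))"

text \<open>Only \<open>P 0, \<dots>, P (k - 1)\<close> matter. Pieces may be empty.\<close>

definition borel_generator ::
    "('g, 'b) monoid_scheme \<Rightarrow> 'a measure \<Rightarrow> ('g \<Rightarrow> 'a \<Rightarrow> 'a) \<Rightarrow> nat \<Rightarrow> (nat \<Rightarrow> 'a set) \<Rightarrow> bool"
  where "borel_generator G M \<phi> k P \<longleftrightarrow>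
    (\<forall>n<k. P n \<in> sets M) \<and> disjoint_family_on P {..<k} \<and> (\<Union>n<k. P n) = space M \<and>
    sets M = sigma_sets (space M) {\<phi> g ` P n | g n. g \<in> carrier G \<and> n < k}"

end

theory Submission
  imports Defs
begin

text \<open>Let \<open>\<C>\<close> be the \<open>\<sigma>\<close>-algebra generated by the translates of the given complete section
  \<open>A\<close>. Suppose there are injections \<open>f n\<close> of \<open>A\<close> into \<open>X\<close> with pairwise disjoint images that act by
  group elements on pieces from \<open>\<C>\<close>. For a sequence \<open>U n\<close> generating the Borel sets, put
  \<open>B = (\<Union>n. f n ` (A \<inter> U n))\<close>. The translates of \<open>A\<close> and \<open>B\<close> recover
  \<open>A \<inter> U n = {x \<in> A. f n x \<in> B}\<close>, hence all Borel sets, and \<open>A\<close>, \<open>B\<close> cut \<open>X\<close> into four pieces.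

  Choosing an infinite family of disjoint translates of \<open>A\<close> separately on each orbit need not be
  Borel, but finite families can be chosen among countably many, which suffices to build the \<open>f n\<close>.
  Keep matching fresh copies of \<open>A\<close> maximally into the unused part of \<open>X\<close>. On the orbits where every
  copy fits, this already gives all \<open>f n\<close>. On an orbit where copy \<open>n\<close> does not fit, copies
  \<open>0, \<dots>, n\<close> exhaust the orbit, while \<open>2n + 2\<close> translates of \<open>A\<close> are disjoint there; so the orbit
  embeds twice disjointly into itself, and iterating yields infinitely many disjoint copies.\<close>

section \<open>Elementary facts about group actions\<close>

context group_action
begin

sublocale group G
  using group_hom by (rule group_hom.axioms(1))

lemma action_closed [simp]: "\<lbrakk>g \<in> carrier G; x \<in> E\<rbrakk> \<Longrightarrow> \<phi> g x \<in> E"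
  using element_image by blast

lemma action_inv_left [simp]: "\<lbrakk>g \<in> carrier G; x \<in> E\<rbrakk> \<Longrightarrow> \<phi> (inv g) (\<phi> g x) = x"
  using orbit_sym_aux by blast

lemma action_inv_right [simp]: "\<lbrakk>g \<in> carrier G; x \<in> E\<rbrakk> \<Longrightarrow> \<phi> g (\<phi> (inv g) x) = x"
  using orbit_sym_aux[of "inv g" x] by simp

lemma action_one [simp]: "x \<in> E \<Longrightarrow> \<phi> \<one> x = x"
  using id_eq_one by (metis restrict_apply')

lemma translate_eq_vimage:
  assumes "g \<in> carrier G" "S \<subseteq> E"
  shows "\<phi> g ` S = {x \<in> E. \<phi> (inv g) x \<in> S}"
proof
  show "\<phi> g ` S \<subseteq> {x \<in> E. \<phi> (inv g) x \<in> S}"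
    using assms by (auto simp: subset_iff)
  show "{x \<in> E. \<phi> (inv g) x \<in> S} \<subseteq> \<phi> g ` S"
    using assms by (auto simp: image_iff) (metis action_inv_right)
qed

end

section \<open>Maps that act by group elements on countably many pieces\<close>

text \<open>\<open>\<C>\<close> is left arbitrary because the proof works over three
  \<sigma>-algebras: the Borel sets, the one generated by the translates of the complete section,
  and the one generated by the translates of the four pieces.\<close>

locale invariant_sigma_algebra = group_action G \<Omega> \<phi> + sigma_algebra \<Omega> \<C>
  for G (structure) and \<Omega> :: "'a set" and \<phi> and \<C> +
  assumes countable_carrier: "countable (carrier G)"
    and translate: "\<lbrakk>g \<in> carrier G; S \<in> \<C>\<rbrakk> \<Longrightarrow> \<phi> g ` S \<in> \<C>"
begin

lemma vimage_sets:
  assumes "g \<in> carrier G" "S \<in> \<C>"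
  shows "{x \<in> \<Omega>. \<phi> g x \<in> S} \<in> \<C>"
  using translate_eq_vimage[of "inv g" S] translate[of "inv g" S] sets_into_space[of S] assms
  by simp

text \<open>The pieces may overlap: \<open>f\<close> is given beforehand, and each piece only has to
  lie in \<open>\<C>\<close> and agree with one translation. Unions and composites therefore need no
  disjointification.\<close>

definition piecewise :: "('a \<Rightarrow> 'a) \<Rightarrow> 'a set \<Rightarrow> bool"
  where "piecewise f D \<longleftrightarrow>
    (\<exists>P. (\<forall>g\<in>carrier G. P g \<in> \<C> \<and> (\<forall>x\<in>P g. f x = \<phi> g x)) \<and> D = (\<Union>g\<in>carrier G. P g))"

lemma piecewise_sets: "piecewise f D \<Longrightarrow> D \<in> \<C>"
  unfolding piecewise_def using countable_carrier by (auto intro!: countable_UN'')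

lemma piecewise_subset: "piecewise f D \<Longrightarrow> D \<subseteq> \<Omega>"
  using piecewise_sets sets_into_space by blast

lemma piecewise_orbit:
  assumes "piecewise f D" "x \<in> D"
  obtains g where "g \<in> carrier G" "f x = \<phi> g x"
  using assms unfolding piecewise_def by blast

lemma piecewise_image_sets:
  assumes "piecewise f D"
  shows "f ` D \<in> \<C>"
proof -
  from assms obtain P where P: "\<And>g. g \<in> carrier G \<Longrightarrow> P g \<in> \<C>"
    "\<And>g x. g \<in> carrier G \<Longrightarrow> x \<in> P g \<Longrightarrow> f x = \<phi> g x" "D = (\<Union>g\<in>carrier G. P g)"
    unfolding piecewise_def by blast
  have "f ` D = (\<Union>g\<in>carrier G. \<phi> g ` P g)"
    unfolding P(3) image_UN using P(2) by (intro SUP_cong refl image_cong) auto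
  then show ?thesis
    using countable_carrier translate P(1) by (auto intro!: countable_UN'')
qed

text \<open>This is how the generator is decoded: the set of points of \<open>A\<close> sent into
  \<open>B\<close> lies in any \<open>\<C>\<close> that contains \<open>B\<close> and over which the
  map is piecewise.\<close>

lemma piecewise_vimage_sets:
  assumes "piecewise f D" "S \<in> \<C>"
  shows "{x \<in> D. f x \<in> S} \<in> \<C>"
proof -
  from assms(1) obtain P where P: "\<And>g. g \<in> carrier G \<Longrightarrow> P g \<in> \<C>"
    "\<And>g x. g \<in> carrier G \<Longrightarrow> x \<in> P g \<Longrightarrow> f x = \<phi> g x" "D = (\<Union>g\<in>carrier G. P g)"
    unfolding piecewise_def by blast
  have "{x \<in> D. f x \<in> S} = (\<Union>g\<in>carrier G. P g \<inter> {x \<in> \<Omega>. \<phi> g x \<in> S})"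
    using P(2,3) piecewise_subset[OF assms(1)] by fastforce
  then show ?thesis
    using countable_carrier vimage_sets P(1) assms(2) by (auto intro!: countable_UN'')
qed

lemma piecewise_restrict:
  assumes "piecewise f D" "E \<in> \<C>" "E \<subseteq> D"
  shows "piecewise f E"
proof -
  from assms(1) obtain P where P: "\<And>g. g \<in> carrier G \<Longrightarrow> P g \<in> \<C>"
    "\<And>g x. g \<in> carrier G \<Longrightarrow> x \<in> P g \<Longrightarrow> f x = \<phi> g x" "D = (\<Union>g\<in>carrier G. P g)"
    unfolding piecewise_def by blast
  then show ?thesis
    unfolding piecewise_def using assms(2,3) by (intro exI[of _ "\<lambda>g. P g \<inter> E"]) auto
qed

lemma piecewise_cong:
  assumes "piecewise f D" "\<And>x. x \<in> D \<Longrightarrow> f' x = f x"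
  shows "piecewise f' D"
  using assms unfolding piecewise_def by (metis UN_I)

lemma piecewise_UN:
  assumes "countable I" "\<And>i. i \<in> I \<Longrightarrow> piecewise f (D i)"
  shows "piecewise f (\<Union>i\<in>I. D i)"
proof -
  from assms(2) obtain P where P: "\<And>i g. i \<in> I \<Longrightarrow> g \<in> carrier G \<Longrightarrow> P i g \<in> \<C>"
    "\<And>i g x. i \<in> I \<Longrightarrow> g \<in> carrier G \<Longrightarrow> x \<in> P i g \<Longrightarrow> f x = \<phi> g x"
    "\<And>i. i \<in> I \<Longrightarrow> D i = (\<Union>g\<in>carrier G. P i g)"
    unfolding piecewise_def by metis
  then show ?thesis
    unfolding piecewise_def using assms(1)
    by (intro exI[of _ "\<lambda>g. \<Union>i\<in>I. P i g"]) (auto intro!: countable_UN'')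
qed

lemma piecewise_action:
  assumes "g \<in> carrier G" "D \<in> \<C>"
  shows "piecewise (\<phi> g) D"
  unfolding piecewise_def using assms by (intro exI[of _ "\<lambda>h. if h = g then D else {}"]) auto

lemma piecewise_compose:
  assumes f: "piecewise f D" and h: "piecewise h E" and sub: "f ` D \<subseteq> E"
  shows "piecewise (h \<circ> f) D"
proof -
  from f obtain P where P: "\<And>g. g \<in> carrier G \<Longrightarrow> P g \<in> \<C>"
    "\<And>g x. g \<in> carrier G \<Longrightarrow> x \<in> P g \<Longrightarrow> f x = \<phi> g x" "D = (\<Union>g\<in>carrier G. P g)"
    unfolding piecewise_def by blast
  from h obtain Q where Q: "\<And>g. g \<in> carrier G \<Longrightarrow> Q g \<in> \<C>"
    "\<And>g x. g \<in> carrier G \<Longrightarrow> x \<in> Q g \<Longrightarrow> h x = \<phi> g x" "E = (\<Union>g\<in>carrier G. Q g)"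
    unfolding piecewise_def by blast
  \<comment> \<open>\<open>R k\<close> collects the points moved by \<open>k\<close> in total: after
    a first move by \<open>g\<close>, the second must be by
    \<open>k \<otimes> inv g\<close>.\<close>
  define R where "R k = (\<Union>g\<in>carrier G. P g \<inter> {x \<in> \<Omega>. \<phi> g x \<in> Q (k \<otimes> inv g)})" for k
  have "R k \<in> \<C>" if "k \<in> carrier G" for k
    unfolding R_def using that P(1) Q(1) countable_carrier
    by (intro countable_UN'' Int vimage_sets) auto
  moreover have "(h \<circ> f) x = \<phi> k x" if k: "k \<in> carrier G" and "x \<in> R k" for k x
  proof -
    from \<open>x \<in> R k\<close> obtain g where g: "g \<in> carrier G" "x \<in> P g" "x \<in> \<Omega>" "\<phi> g x \<in> Q (k \<otimes> inv g)"
      unfolding R_def by blast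
    then have "(h \<circ> f) x = \<phi> (k \<otimes> inv g) (\<phi> g x)"
      using P(2) Q(2) k by simp
    also have "\<dots> = \<phi> (k \<otimes> inv g \<otimes> g) x"
      using composition_rule[of x "k \<otimes> inv g" g] g k by simp
    also have "\<dots> = \<phi> k x"
      using g k by (simp add: m_assoc)
    finally show ?thesis .
  qed
  moreover have "D = (\<Union>k\<in>carrier G. R k)"
  proof
    show "(\<Union>k\<in>carrier G. R k) \<subseteq> D"
      unfolding R_def P(3) by blast
    show "D \<subseteq> (\<Union>k\<in>carrier G. R k)"
    proof
      fix x assume "x \<in> D"
      then obtain g where g: "g \<in> carrier G" "x \<in> P g"
        using P(3) by blast
      have "f x \<in> E" using sub \<open>x \<in> D\<close> by blast
      then obtain g' where g': "g' \<in> carrier G" "f x \<in> Q g'"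
        using Q(3) by blast
      have "x \<in> \<Omega>" using piecewise_subset[OF f] \<open>x \<in> D\<close> by blast
      have "x \<in> R (g' \<otimes> g)"
        unfolding R_def using g g' \<open>x \<in> \<Omega>\<close> P(2)[OF g] by (auto simp: m_assoc)
      then show "x \<in> (\<Union>k\<in>carrier G. R k)"
        using g g' by blast
    qed
  qed
  ultimately show ?thesis
    unfolding piecewise_def by (intro exI[of _ R]) blast
qed

lemma piecewise_inv_into:
  assumes f: "piecewise f D" and inj: "inj_on f D"
  shows "piecewise (inv_into D f) (f ` D)"
proof -
  from f obtain P where P: "\<And>g. g \<in> carrier G \<Longrightarrow> P g \<in> \<C>"
    "\<And>g x. g \<in> carrier G \<Longrightarrow> x \<in> P g \<Longrightarrow> f x = \<phi> g x" "D = (\<Union>g\<in>carrier G. P g)"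
    unfolding piecewise_def by blast
  \<comment> \<open>A point that \<open>f\<close> moved by \<open>inv g\<close> is brought back by
    \<open>g\<close>.\<close>
  define Q where "Q g = \<phi> (inv g) ` P (inv g)" for g
  have "Q g \<in> \<C>" if "g \<in> carrier G" for g
    unfolding Q_def using that P(1) translate by simp
  moreover have "inv_into D f y = \<phi> g y" if g: "g \<in> carrier G" and "y \<in> Q g" for g y
  proof -
    from \<open>y \<in> Q g\<close> obtain x where x: "x \<in> P (inv g)" "y = \<phi> (inv g) x"
      unfolding Q_def by blast
    then have "x \<in> D" "y = f x"
      using P(2)[of "inv g" x] P(3) g inv_closed by (blast, simp)
    moreover have "x \<in> \<Omega>"
      using \<open>x \<in> D\<close> piecewise_subset[OF f] by blast
    ultimately show ?thesis
      using inj x(2) g by (metis action_inv_right inv_into_f_f)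
  qed
  moreover have "f ` D = (\<Union>g\<in>carrier G. Q g)"
  proof
    show "f ` D \<subseteq> (\<Union>g\<in>carrier G. Q g)"
    proof
      fix y assume "y \<in> f ` D"
      then obtain x g where "g \<in> carrier G" "x \<in> P g" "y = \<phi> g x"
        using P(2,3) by auto
      then have "y \<in> Q (inv g)"
        unfolding Q_def by simp
      then show "y \<in> (\<Union>g\<in>carrier G. Q g)"
        using \<open>g \<in> carrier G\<close> by blast
    qed
    show "(\<Union>g\<in>carrier G. Q g) \<subseteq> f ` D"
    proof
      fix y assume "y \<in> (\<Union>g\<in>carrier G. Q g)"
      then obtain g x where "g \<in> carrier G" "x \<in> P (inv g)" "y = \<phi> (inv g) x"
        unfolding Q_def by blast
      then have "y = f x" "x \<in> D"
        using P(2)[of "inv g" x] P(3) inv_closed by (simp, blast)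
      then show "y \<in> f ` D" by blast
    qed
  qed
  ultimately show ?thesis
    unfolding piecewise_def by (intro exI[of _ Q]) blast
qed

section \<open>Invariant sets and saturations\<close>

definition invariant :: "'a set \<Rightarrow> bool"
  where "invariant Z \<longleftrightarrow> Z \<in> \<C> \<and> (\<forall>g\<in>carrier G. \<forall>x\<in>Z. \<phi> g x \<in> Z)"

lemma invariant_iff:
  assumes "invariant Z" "g \<in> carrier G" "x \<in> \<Omega>"
  shows "\<phi> g x \<in> Z \<longleftrightarrow> x \<in> Z"
  using assms unfolding invariant_def by (metis action_inv_left inv_closed)

lemma invariant_Int: "\<lbrakk>invariant Z; invariant W\<rbrakk> \<Longrightarrow> invariant (Z \<inter> W)"
  unfolding invariant_def by auto

lemma invariant_compl: "invariant Z \<Longrightarrow> invariant (\<Omega> - Z)"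
  using invariant_iff[of Z] by (auto simp: invariant_def)

definition saturation :: "'a set \<Rightarrow> 'a set"
  where "saturation S = (\<Union>g\<in>carrier G. \<phi> g ` S)"

lemma invariant_saturation:
  assumes "S \<in> \<C>"
  shows "invariant (saturation S)"
  unfolding invariant_def saturation_def
proof (intro conjI ballI)
  show "(\<Union>g\<in>carrier G. \<phi> g ` S) \<in> \<C>"
    using assms countable_carrier translate by (intro countable_UN'') auto
  fix g x assume g: "g \<in> carrier G" and "x \<in> (\<Union>g\<in>carrier G. \<phi> g ` S)"
  then obtain h s where h: "h \<in> carrier G" "s \<in> S" "x = \<phi> h s" by blast
  then have "\<phi> g x = \<phi> (g \<otimes> h) s"
    using composition_rule[of s g h] g sets_into_space[OF assms] by auto
  then show "\<phi> g x \<in> (\<Union>g\<in>carrier G. \<phi> g ` S)"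
    using g h by blast
qed

lemma invariant_UN:
  "\<lbrakk>countable I; \<And>i. i \<in> I \<Longrightarrow> invariant (Z i)\<rbrakk> \<Longrightarrow> invariant (\<Union>i\<in>I. Z i)"
  unfolding invariant_def by (auto intro!: countable_UN'')

lemma saturation_superset:
  assumes "S \<subseteq> \<Omega>"
  shows "S \<subseteq> saturation S"
proof
  fix x assume "x \<in> S"
  then have "\<phi> \<one> x \<in> saturation S"
    unfolding saturation_def by blast
  then show "x \<in> saturation S"
    using \<open>x \<in> S\<close> assms by auto
qed

text \<open>A piecewise map moves points within their orbits, and an invariant set is a union of
  orbits.\<close>

lemma piecewise_invariant:
  assumes "piecewise f D" "invariant Z" "x \<in> D"
  shows "f x \<in> Z \<longleftrightarrow> x \<in> Z"
proof -
  obtain g where "g \<in> carrier G" "f x = \<phi> g x"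
    using piecewise_orbit[OF assms(1,3)] .
  then show ?thesis
    using invariant_iff[OF assms(2)] piecewise_subset[OF assms(1)] assms(3) by auto
qed

section \<open>Infinitely many disjoint copies of a set\<close>

text \<open>Injectivity on pairs says at once that each \<open>f n\<close> is injective and that the
  images for different \<open>n\<close> are disjoint.\<close>

definition infinitely_embeds :: "'a set \<Rightarrow> 'a set \<Rightarrow> bool"
  where "infinitely_embeds A Z \<longleftrightarrow>
    (\<exists>f::nat \<Rightarrow> 'a \<Rightarrow> 'a. (\<forall>n. piecewise (f n) (A \<inter> Z)) \<and>
      inj_on (\<lambda>(n, x). f n x) (UNIV \<times> (A \<inter> Z)))"

text \<open>The zones may overlap, so each point uses the embedding of the first zone containing it.
  The index of that zone is constant on orbits and piecewise maps respect orbits, so points with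
  different first zones never collide.\<close>

lemma infinitely_embeds_glue:
  fixes Z :: "nat \<Rightarrow> 'a set"
  assumes A: "A \<in> \<C>" and Z: "\<And>j. invariant (Z j)" and cover: "\<Omega> = (\<Union>j. Z j)"
    and emb: "\<And>j. infinitely_embeds A (Z j)"
  shows "infinitely_embeds A \<Omega>"
proof -
  from emb obtain f where f: "\<And>j n. piecewise (f j n) (A \<inter> Z j)"
    "\<And>j. inj_on (\<lambda>(n::nat, x). f j n x) (UNIV \<times> (A \<inter> Z j))"
    unfolding infinitely_embeds_def by metis
  define J where "J x = (LEAST j. x \<in> Z j)" for x
  have J: "x \<in> Z (J x)" if "x \<in> \<Omega>" for x
    using that cover unfolding J_def by (auto intro: LeastI)
  define F where "F n x = f (J x) n x" for n x
  define E where "E j = A \<inter> (Z j - (\<Union>i<j. Z i))" for j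
  have J_eq: "J x = j" if "x \<in> E j" for x j
    unfolding J_def using that by (intro Least_equality) (auto simp: E_def not_less[symmetric])
  have E_sets: "E j \<in> \<C>" for j
    using A Z unfolding E_def invariant_def by (intro Int Diff countable_UN'') auto
  have E_cover: "A \<inter> \<Omega> = (\<Union>j. E j)"
  proof
    show "A \<inter> \<Omega> \<subseteq> (\<Union>j. E j)"
    proof
      fix x assume "x \<in> A \<inter> \<Omega>"
      then have "x \<in> E (J x)"
        using J[of x] by (auto simp: E_def J_def dest: not_less_Least)
      then show "x \<in> (\<Union>j. E j)" by blast
    qed
    show "(\<Union>j. E j) \<subseteq> A \<inter> \<Omega>"
      using cover by (auto simp: E_def)
  qed
  have "piecewise (F n) (E j)" for n j
    using piecewise_restrict[OF f(1)[of j n] E_sets[of j]]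
    by (rule piecewise_cong) (auto simp: F_def J_eq E_def)
  then have pw: "piecewise (F n) (A \<inter> \<Omega>)" for n
    unfolding E_cover by (intro piecewise_UN) auto
  have J_F: "J (F n x) = J x" if "x \<in> A \<inter> \<Omega>" for n x
    unfolding J_def using piecewise_invariant[OF pw Z that] by simp
  have "inj_on (\<lambda>(n, x). F n x) (UNIV \<times> (A \<inter> \<Omega>))"
  proof (intro inj_onI, clarify)
    fix n m x y assume x: "x \<in> A" "x \<in> \<Omega>" and y: "y \<in> A" "y \<in> \<Omega>" and eq: "F n x = F m y"
    have "J x = J y"
      using J_F[of x n] J_F[of y m] x y eq by simp
    moreover have "f (J x) n x = f (J x) m y"
      using eq \<open>J x = J y\<close> by (simp add: F_def)
    ultimately show "n = m \<and> x = y"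
      using inj_onD[OF f(2)[of "J x"], of "(n, x)" "(m, y)"] J[of x] J[of y] x y by auto
  qed
  with pw show ?thesis
    unfolding infinitely_embeds_def by blast
qed

text \<open>A paradoxical zone: \<open>u\<close>, \<open>v \<circ> u\<close>, \<open>v \<circ> v \<circ> u\<close>, \<dots> have pairwise disjoint images.\<close>

lemma infinitely_embeds_paradoxical:
  assumes A: "A \<in> \<C>" and Z: "invariant Z"
    and u: "piecewise u Z" "inj_on u Z" and v: "piecewise v Z" "inj_on v Z"
    and disj: "u ` Z \<inter> v ` Z = {}"
  shows "infinitely_embeds A Z"
proof -
  have uZ: "u x \<in> Z" and vZ: "v x \<in> Z" if "x \<in> Z" for x
    using piecewise_invariant[OF u(1) Z] piecewise_invariant[OF v(1) Z] that by auto
  have vnZ: "(v ^^ n) x \<in> Z" if "x \<in> Z" for n x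
    using that by (induction n) (auto simp: vZ)
  have pw: "piecewise (v ^^ n \<circ> u) Z" for n
  proof (induction n)
    case 0
    then show ?case using u(1) by (simp add: id_def comp_def)
  next
    case (Suc n)
    have "piecewise (v \<circ> (v ^^ n \<circ> u)) Z"
      using Suc v(1) by (rule piecewise_compose) (auto simp: uZ vnZ)
    then show ?case by (simp add: comp_def)
  qed
  have inj_vn: "inj_on (v ^^ n) Z" for n
  proof (induction n)
    case (Suc n)
    then show ?case
      using v(2) vnZ by (auto simp: inj_on_def)
  qed auto
  \<comment> \<open>Cancelling \<open>v ^^ n\<close> would leave \<open>u x\<close> in the image of
    \<open>v\<close>.\<close>
  have less: "(v ^^ n) (u x) \<noteq> (v ^^ m) (u y)" if "n < m" "x \<in> Z" "y \<in> Z" for n m x y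
  proof
    assume eq: "(v ^^ n) (u x) = (v ^^ m) (u y)"
    obtain k where k: "m = n + Suc k"
      using \<open>n < m\<close> less_iff_Suc_add by auto
    have "(v ^^ n) (u x) = (v ^^ n) ((v ^^ Suc k) (u y))"
      using eq k by (simp only: funpow_add comp_apply)
    then have "u x = (v ^^ Suc k) (u y)"
      using inj_onD[OF inj_vn] uZ vnZ that by blast
    also have "\<dots> \<in> v ` Z"
      using vnZ[OF uZ[OF \<open>y \<in> Z\<close>]] by auto
    finally show False
      using disj \<open>x \<in> Z\<close> by blast
  qed
  have "inj_on (\<lambda>(n, x). (v ^^ n \<circ> u) x) (UNIV \<times> (A \<inter> Z))"
  proof (intro inj_onI, clarify)
    fix n m x y assume x: "x \<in> Z" and y: "y \<in> Z" and eq: "(v ^^ n \<circ> u) x = (v ^^ m \<circ> u) y"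
    then have "n = m"
      using less[of n m x y] less[of m n y x] by (metis comp_apply linorder_neqE_nat)
    moreover have "u x = u y"
      using eq inj_onD[OF inj_vn, of n "u x" "u y"] uZ x y \<open>n = m\<close> by simp
    ultimately show "n = m \<and> x = y"
      using inj_onD[OF u(2)] x y by blast
  qed
  moreover have "piecewise (v ^^ n \<circ> u) (A \<inter> Z)" for n
    using pw by (rule piecewise_restrict) (use A Z in \<open>auto simp: invariant_def\<close>)
  ultimately show ?thesis
    unfolding infinitely_embeds_def by (intro exI[of _ "\<lambda>n. v ^^ n \<circ> u"]) blast
qed

section \<open>Greedy matchings\<close>

text \<open>Run through an enumeration \<open>e\<close> of the group and, at stage \<open>n\<close>,
  match by \<open>e n\<close> every still unmatched point of \<open>A\<close> whose image is a still
  free point of \<open>R\<close>. A free target \<open>\<phi> g x\<close> of a leftover point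
  \<open>x\<close> would have been taken at a stage for \<open>g\<close>.\<close>

lemma maximal_matching:
  assumes A: "A \<in> \<C>" and R: "R \<in> \<C>"
  obtains D f where "D \<subseteq> A" "piecewise f D" "inj_on f D" "f ` D \<subseteq> R"
    "\<And>x g. \<lbrakk>x \<in> A - D; g \<in> carrier G; \<phi> g x \<in> R\<rbrakk> \<Longrightarrow> \<phi> g x \<in> f ` D"
proof -
  define e where "e = from_nat_into (carrier G)"
  have e: "e n \<in> carrier G" for n
    unfolding e_def by (rule from_nat_into) blast
  have e_surj: "\<exists>n. e n = g" if "g \<in> carrier G" for g
    unfolding e_def using from_nat_into_surj[OF countable_carrier that] .
  \<comment> \<open>The state is the pair of matched points and used targets.\<close>
  define step where "step n S =
    (let P = {x \<in> A - fst S. \<phi> (e n) x \<in> R - snd S} in (fst S \<union> P, snd S \<union> \<phi> (e n) ` P))"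
    for n and S :: "'a set \<times> 'a set"
  define S where "S = rec_nat ({}, {}) step"
  define P where "P n = {x \<in> A - fst (S n). \<phi> (e n) x \<in> R - snd (S n)}" for n
  have S_0: "S 0 = ({}, {})" and S_Suc: "S (Suc n) = (fst (S n) \<union> P n, snd (S n) \<union> \<phi> (e n) ` P n)" for n
    by (simp_all add: S_def step_def P_def Let_def)
  have fst_S: "fst (S n) = (\<Union>i<n. P i)" and snd_S: "snd (S n) = (\<Union>i<n. \<phi> (e i) ` P i)" for n
    by (induction n) (auto simp: S_0 S_Suc lessThan_Suc)
  have A_sub: "A \<subseteq> \<Omega>" using A sets_into_space by blast
  have P_sets: "fst (S n) \<in> \<C> \<and> snd (S n) \<in> \<C> \<and> P n \<in> \<C>" for n
  proof (induction n)
    case 0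
    have "P 0 = A \<inter> {x \<in> \<Omega>. \<phi> (e 0) x \<in> R}"
      using A_sub by (auto simp: P_def S_0)
    then show ?case
      using A R e vimage_sets by (auto simp: S_0)
  next
    case (Suc n)
    then have "fst (S (Suc n)) \<in> \<C>" "snd (S (Suc n)) \<in> \<C>"
      using translate e by (auto simp: S_Suc)
    moreover have "P (Suc n) = (A - fst (S (Suc n))) \<inter> {x \<in> \<Omega>. \<phi> (e (Suc n)) x \<in> R - snd (S (Suc n))}"
      using A_sub by (auto simp: P_def)
    moreover have "{x \<in> \<Omega>. \<phi> (e (Suc n)) x \<in> R - snd (S (Suc n))} \<in> \<C>"
      using calculation(2) R e by (intro vimage_sets) auto
    ultimately show ?case
      using A by (metis Diff Int)
  qed
  define D where "D = (\<Union>n. P n)"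
  define N where "N x = (LEAST n. x \<in> P n)" for x
  have N: "x \<in> P (N x)" if "x \<in> D" for x
    using that unfolding D_def N_def by (auto intro: LeastI)
  have N_eq: "N x = n" if "x \<in> P n" for x n
    unfolding N_def
  proof (rule Least_equality)
    show "x \<in> P n" by fact
    fix m assume "x \<in> P m"
    then show "n \<le> m"
      using that by (cases "m < n") (auto simp: P_def[of n] fst_S)
  qed
  define f where "f x = \<phi> (e (N x)) x" for x
  have f_P: "f x = \<phi> (e n) x" if "x \<in> P n" for n x
    using N_eq[OF that] by (simp add: f_def)
  have image: "f ` P n = \<phi> (e n) ` P n" for n
    using f_P by (intro image_cong) auto
  show thesis
  proof
    show "D \<subseteq> A"
      by (auto simp: D_def P_def)
    have "piecewise f (P n)" for n
      using piecewise_action[OF e] P_sets[of n] f_P by (blast intro: piecewise_cong)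
    then show "piecewise f D"
      unfolding D_def by (intro piecewise_UN) auto
    show "f ` D \<subseteq> R"
      using N by (auto simp: f_def P_def)
    have less: "f x \<noteq> f y" if "x \<in> P m" "y \<in> P n" "m < n" for x y m n
    proof -
      have "f x \<in> snd (S n)"
        using that f_P by (auto simp: snd_S)
      moreover have "f y \<notin> snd (S n)"
        using that f_P by (auto simp: P_def)
      ultimately show ?thesis by metis
    qed
    show "inj_on f D"
    proof (rule inj_onI)
      fix x y assume x: "x \<in> D" and y: "y \<in> D" and eq: "f x = f y"
      have "N x = N y"
        using less[OF N[OF x] N[OF y]] less[OF N[OF y] N[OF x]] eq
        by (metis linorder_neqE_nat)
      then show "x = y"
        using eq inj_onD[OF inj_prop[OF e]] x y A_sub \<open>D \<subseteq> A\<close> unfolding f_def by (metis subsetD)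
    qed
    fix x g assume x: "x \<in> A - D" and "g \<in> carrier G" and gx: "\<phi> g x \<in> R"
    then obtain n where n: "e n = g"
      using e_surj by blast
    have "x \<notin> fst (S n)" "x \<notin> P n"
      using x by (auto simp: D_def fst_S)
    then have "\<phi> g x \<in> snd (S n)"
      using x gx n by (auto simp: P_def)
    then show "\<phi> g x \<in> f ` D"
      unfolding snd_S D_def image[symmetric] by blast
  qed
qed

text \<open>Match copy \<open>n\<close> into what the earlier copies left free. If a point of copy
  \<open>n\<close> stays unmatched, every point of its orbit is hit by an earlier copy or, by
  maximality, by copy \<open>n\<close> itself.\<close>

lemma maximal_matching_sequence:
  assumes A: "A \<in> \<C>"
  obtains D :: "nat \<Rightarrow> 'a set" and f where
    "\<And>n. D n \<subseteq> A" "\<And>n. piecewise (f n) (D n)" "\<And>n. inj_on (f n) (D n)"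
    "\<And>m n. m \<noteq> n \<Longrightarrow> f m ` D m \<inter> f n ` D n = {}"
    "\<And>n x g. \<lbrakk>x \<in> A - D n; g \<in> carrier G\<rbrakk> \<Longrightarrow> \<phi> g x \<in> (\<Union>i\<le>n. f i ` D i)"
proof -
  define good where "good R D f \<longleftrightarrow> D \<subseteq> A \<and> piecewise f D \<and> inj_on f D \<and> f ` D \<subseteq> R \<and>
    (\<forall>x\<in>A - D. \<forall>g\<in>carrier G. \<phi> g x \<in> R \<longrightarrow> \<phi> g x \<in> f ` D)" for R D f
  have "\<exists>D f. good R D f" if "R \<in> \<C>" for R
    using maximal_matching[OF A that] unfolding good_def by metis
  then obtain dom m where good: "\<And>R. R \<in> \<C> \<Longrightarrow> good R (dom R) (m R)"
    by metis
  define R where "R = rec_nat \<Omega> (\<lambda>_ R. R - m R ` dom R)"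
  have R_0: "R 0 = \<Omega>" and R_Suc: "R (Suc n) = R n - m (R n) ` dom (R n)" for n
    by (simp_all add: R_def)
  have R_sets: "R n \<in> \<C>" for n
    by (induction n) (use good piecewise_image_sets in \<open>auto simp: R_0 R_Suc good_def\<close>)
  define D where "D n = dom (R n)" for n
  define f where "f n = m (R n)" for n
  have good_n: "good (R n) (D n) (f n)" for n
    unfolding D_def f_def by (rule good[OF R_sets])
  have R_eq: "R n = \<Omega> - (\<Union>i<n. f i ` D i)" for n
    by (induction n) (auto simp: R_0 R_Suc lessThan_Suc D_def f_def)
  have less: "f m ` D m \<inter> f n ` D n = {}" if "m < n" for m n
  proof -
    have "f n ` D n \<subseteq> \<Omega> - (\<Union>i<n. f i ` D i)"
      using good_n[of n] by (simp add: good_def R_eq)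
    then show ?thesis using that by blast
  qed
  show thesis
  proof
    show "D n \<subseteq> A" "piecewise (f n) (D n)" "inj_on (f n) (D n)" for n
      using good_n[of n] by (auto simp: good_def)
    show "f m ` D m \<inter> f n ` D n = {}" if "m \<noteq> n" for m n
      using less[of m n] less[of n m] that by (cases "m < n") auto
    fix n x g assume x: "x \<in> A - D n" and g: "g \<in> carrier G"
    have "x \<in> \<Omega>"
      using x sets_into_space[OF A] by blast
    then have "\<phi> g x \<in> \<Omega>"
      using g by simp
    then have "\<phi> g x \<in> (\<Union>i<n. f i ` D i) \<or> \<phi> g x \<in> f n ` D n"
      using good_n[of n] x g unfolding good_def R_eq by blast
    then show "\<phi> g x \<in> (\<Union>i\<le>n. f i ` D i)"
      by (auto simp: less_imp_le)
  qed
qed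

section \<open>Orbits on which finitely many given translates are disjoint\<close>

text \<open>The union of the orbits free of overlaps between the translates. A list gives indices to
  address its entries, and there are only countably many lists over the group.\<close>

definition clique_zone :: "'a set \<Rightarrow> 'b list \<Rightarrow> 'a set"
  where "clique_zone A hs = \<Omega> -
    saturation (\<Union>i<length hs. \<Union>j\<in>{..<length hs} - {i}. \<phi> (hs ! i) ` A \<inter> \<phi> (hs ! j) ` A)"

lemma invariant_clique_zone:
  assumes "A \<in> \<C>" "set hs \<subseteq> carrier G"
  shows "invariant (clique_zone A hs)"
  unfolding clique_zone_def using assms translate
  by (intro invariant_compl invariant_saturation countable_UN'' Int) (auto simp: subset_iff)

text \<open>If the orbit of \<open>x\<close> contains a common point of two translates, that point
  comes from points of \<open>A\<close> in the orbit of \<open>x\<close>. So disjointness has only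
  to be tested on that orbit.\<close>

lemma clique_zoneI:
  assumes A: "A \<subseteq> \<Omega>" and x: "x \<in> \<Omega>" and hs: "set hs \<subseteq> carrier G"
    and disj: "\<And>i j. \<lbrakk>i < length hs; j < length hs; i \<noteq> j\<rbrakk> \<Longrightarrow>
      \<phi> (hs ! i) ` (A \<inter> orbit G \<phi> x) \<inter> \<phi> (hs ! j) ` (A \<inter> orbit G \<phi> x) = {}"
  shows "x \<in> clique_zone A hs"
proof (rule ccontr)
  assume "x \<notin> clique_zone A hs"
  then obtain g z where g: "g \<in> carrier G" and "x = \<phi> g z"
    and "z \<in> (\<Union>i<length hs. \<Union>j\<in>{..<length hs} - {i}. \<phi> (hs ! i) ` A \<inter> \<phi> (hs ! j) ` A)"
    using x unfolding clique_zone_def saturation_def by blast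
  then obtain i j a b where ij: "i < length hs" "j < length hs" "i \<noteq> j"
    and ab: "a \<in> A" "b \<in> A" "\<phi> (hs ! i) a = \<phi> (hs ! j) b" "x = \<phi> g (\<phi> (hs ! i) a)"
    by blast
  have hij: "hs ! i \<in> carrier G" "hs ! j \<in> carrier G"
    using ij hs by auto
  have *: "c \<in> orbit G \<phi> x" if h: "h \<in> carrier G" and c: "c \<in> A" "x = \<phi> g (\<phi> h c)" for h c
  proof -
    have "c \<in> \<Omega>" using A c by blast
    have "c = \<phi> (inv (g \<otimes> h)) x"
      using composition_rule[OF \<open>c \<in> \<Omega>\<close> g h] action_inv_left[of "g \<otimes> h" c] c \<open>c \<in> \<Omega>\<close> g h by simp
    then show ?thesis
      unfolding orbit_def using g h by blast
  qed
  show False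
    using disj[OF ij] *[of "hs ! i" a] *[of "hs ! j" b] ab hij by auto
qed

text \<open>Different indices would make the common value an overlap point, which lies outside the
  zone, while invariance keeps the translate of \<open>a\<close> inside. For equal indices, one
  translation is injective.\<close>

lemma clique_zoneD:
  assumes A: "A \<subseteq> \<Omega>" and inv: "invariant (clique_zone A hs)" and hs: "set hs \<subseteq> carrier G"
    and ij: "i < length hs" "j < length hs" and ab: "a \<in> A \<inter> clique_zone A hs" "b \<in> A"
    and eq: "\<phi> (hs ! i) a = \<phi> (hs ! j) b"
  shows "i = j \<and> a = b"
proof -
  have hi: "hs ! i \<in> carrier G" using hs ij by auto
  have "i = j"
  proof (rule ccontr)
    assume "i \<noteq> j"
    let ?B = "\<Union>i<length hs. \<Union>j\<in>{..<length hs} - {i}. \<phi> (hs ! i) ` A \<inter> \<phi> (hs ! j) ` A"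
    have "\<phi> (hs ! i) a \<in> ?B"
      using \<open>i \<noteq> j\<close> ij ab eq by blast
    moreover have "?B \<subseteq> \<Omega>"
      using A hs by (auto simp: subset_iff)
    ultimately have "\<phi> (hs ! i) a \<notin> clique_zone A hs"
      unfolding clique_zone_def using saturation_superset by blast
    then show False
      using inv hi ab unfolding invariant_def by blast
  qed
  then show ?thesis
    using inj_onD[OF inj_prop[OF hi]] eq ab A by blast
qed

text \<open>Where the first \<open>n + 1\<close> copies of \<open>A\<close> exhaust the space, a clique of size \<open>2n + 2\<close>
  yields two disjoint copies of the whole space, moving the \<open>i\<close>-th copy of \<open>A\<close> onto the translates
  by the clique elements \<open>i\<close> and \<open>n + 1 + i\<close>.\<close>

lemma infinitely_embeds_exhausted:
  fixes f :: "nat \<Rightarrow> 'a \<Rightarrow> 'a"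
  assumes A: "A \<in> \<C>" and D: "\<And>i. D i \<subseteq> A" and f: "\<And>i. piecewise (f i) (D i)" "\<And>i. inj_on (f i) (D i)"
    and hs: "set hs \<subseteq> carrier G" "length hs = 2 * n + 2"
    and Z: "invariant Z" "Z \<subseteq> clique_zone A hs" and cover: "Z \<subseteq> (\<Union>i\<le>n. f i ` D i)"
  shows "infinitely_embeds A Z"
proof -
  \<comment> \<open>The images are not assumed disjoint, so \<open>x\<close> is assigned to the
    first copy covering it; \<open>r x\<close> below is the point of \<open>A\<close> that this copy
    sends to \<open>x\<close>.\<close>
  define I where "I x = (LEAST i. x \<in> f i ` D i)" for x
  have I: "I x \<le> n" "x \<in> f (I x) ` D (I x)" if "x \<in> Z" for x
  proof -
    from that cover obtain i where i: "i \<le> n" "x \<in> f i ` D i" by blast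
    show "x \<in> f (I x) ` D (I x)"
      unfolding I_def by (rule LeastI[of "\<lambda>i. x \<in> f i ` D i", OF i(2)])
    have "I x \<le> i"
      unfolding I_def by (rule Least_le[of "\<lambda>i. x \<in> f i ` D i", OF i(2)])
    with i(1) show "I x \<le> n" by simp
  qed
  define r where "r x = inv_into (D (I x)) (f (I x)) x" for x
  have r: "r x \<in> D (I x)" "f (I x) (r x) = x" if "x \<in> Z" for x
    using I(2)[OF that] by (auto simp: r_def inv_into_into f_inv_into_f)
  have rA: "r x \<in> A \<inter> Z" if "x \<in> Z" for x
    using r[OF that] D piecewise_invariant[OF f(1) Z(1) r(1)[OF that]] that by auto
  define E where "E i = Z \<inter> (f i ` D i - (\<Union>j<i. f j ` D j))" for i
  have E_sets: "E i \<in> \<C>" for i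
    unfolding E_def using Z(1) piecewise_image_sets[OF f(1)] unfolding invariant_def
    by (intro Int Diff countable_UN'') auto
  have I_E: "I x = i" if "x \<in> E i" for x i
    unfolding I_def using that by (intro Least_equality) (auto simp: E_def not_less[symmetric])
  have Z_eq: "Z = (\<Union>i\<le>n. E i)"
  proof
    show "Z \<subseteq> (\<Union>i\<le>n. E i)"
    proof
      fix x assume "x \<in> Z"
      then have "x \<in> E (I x)"
        using I[of x] by (auto simp: E_def I_def dest: not_less_Least)
      then show "x \<in> (\<Union>i\<le>n. E i)"
        using I(1)[OF \<open>x \<in> Z\<close>] by blast
    qed
  qed (auto simp: E_def)
  \<comment> \<open>Only \<open>k = 0\<close> and \<open>k = n + 1\<close> will be used. As
    \<open>I x \<le> n\<close>, the indices \<open>k + I x\<close> then fall into the disjoint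
    blocks from \<open>0\<close> to \<open>n\<close> and from \<open>n + 1\<close> to
    \<open>2n + 1\<close>, so the translate determines both \<open>k\<close> and
    \<open>x\<close>.\<close>
  define w where "w k x = \<phi> (hs ! (k + I x)) (r x)" for k x
  have w_pw: "piecewise (w k) Z" if "k \<le> n + 1" for k
    unfolding Z_eq
  proof (rule piecewise_UN)
    fix i assume "i \<in> {..n}"
    then have h: "hs ! (k + i) \<in> carrier G"
      using that hs by auto
    have "piecewise (inv_into (D i) (f i)) (E i)"
      using piecewise_inv_into[OF f] E_sets by (rule piecewise_restrict) (auto simp: E_def)
    then have "piecewise (\<phi> (hs ! (k + i)) \<circ> inv_into (D i) (f i)) (E i)"
      using piecewise_action[OF h top] by (rule piecewise_compose)
        (use piecewise_subset[OF f(1)[of i]] in \<open>auto simp: E_def f(2)\<close>)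
    then show "piecewise (w k) (E i)"
      by (rule piecewise_cong) (simp add: w_def r_def I_E)
  qed simp
  have w_inj: "k = l \<and> x = y"
    if "k \<in> {0, n + 1}" "l \<in> {0, n + 1}" "x \<in> Z" "y \<in> Z" "w k x = w l y" for k l x y
  proof -
    have "k + I x = l + I y \<and> r x = r y"
    proof (rule clique_zoneD)
      show "invariant (clique_zone A hs)"
        using A hs(1) by (rule invariant_clique_zone)
      show "k + I x < length hs" "l + I y < length hs"
        using that I(1) hs(2) by fastforce+
    qed (use that rA Z(2) hs sets_into_space[OF A] in \<open>auto simp: w_def\<close>)
    moreover from this have "k = l"
      using that I(1)[of x] I(1)[of y] by auto
    ultimately show ?thesis
      using r(2) that by (metis add_left_cancel)
  qed
  show ?thesis
  proof (rule infinitely_embeds_paradoxical[OF A Z(1)])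
    show "piecewise (w 0) Z" "piecewise (w (n + 1)) Z"
      by (simp_all add: w_pw)
    show "inj_on (w 0) Z" "inj_on (w (n + 1)) Z"
      using w_inj by (auto intro!: inj_onI)
    show "w 0 ` Z \<inter> w (n + 1) ` Z = {}"
      using w_inj[of 0 "n + 1"] by auto
  qed
qed

text \<open>Countably many invariant zones cover the space: one where every copy is fully matched
  and, for each \<open>n\<close> and each list of length \<open>2n + 2\<close>, the orbits where
  copy \<open>n\<close> fails and the list gives disjoint translates. Each zone is embedded
  separately and the results are glued.\<close>

lemma infinitely_embeds_of_cliques:
  assumes A: "A \<in> \<C>"
    and clique: "\<And>x k. x \<in> \<Omega> \<Longrightarrow> \<exists>hs. set hs \<subseteq> carrier G \<and> length hs = k \<and> x \<in> clique_zone A hs"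
  shows "infinitely_embeds A \<Omega>"
proof -
  obtain D :: "nat \<Rightarrow> 'a set" and f where D: "\<And>n. D n \<subseteq> A"
    and f: "\<And>n. piecewise (f n) (D n)" "\<And>n. inj_on (f n) (D n)"
    and disj: "\<And>m n. m \<noteq> n \<Longrightarrow> f m ` D m \<inter> f n ` D n = {}"
    and maximal: "\<And>n x g. \<lbrakk>x \<in> A - D n; g \<in> carrier G\<rbrakk> \<Longrightarrow> \<phi> g x \<in> (\<Union>i\<le>n. f i ` D i)"
    using maximal_matching_sequence[OF A] by blast
  define W where "W n = saturation (A - D n)" for n
  have AD_sets: "A - D n \<in> \<C>" for n
    using A piecewise_sets[OF f(1)] by blast
  have W: "invariant (W n)" for n
    unfolding W_def by (rule invariant_saturation[OF AD_sets])
  define good where "good = \<Omega> - (\<Union>n. W n)"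
  have good: "invariant good"
    unfolding good_def using W by (intro invariant_compl invariant_UN) auto
  have "A \<inter> good \<subseteq> D n" for n
    using saturation_superset[OF sets_into_space[OF AD_sets]] unfolding good_def W_def by blast
  then have good_emb: "infinitely_embeds A good"
    unfolding infinitely_embeds_def
  proof (intro exI conjI allI)
    show "piecewise (f n) (A \<inter> good)" for n
      using f(1) by (rule piecewise_restrict)
        (use A good \<open>\<And>n. A \<inter> good \<subseteq> D n\<close> in \<open>auto simp: invariant_def\<close>)
    show "inj_on (\<lambda>(n, x). f n x) (UNIV \<times> (A \<inter> good))"
    proof (intro inj_onI, clarify)
      fix n m x y assume x: "x \<in> A" "x \<in> good" and y: "y \<in> A" "y \<in> good" and eq: "f n x = f m y"
      have xy: "x \<in> D n" "y \<in> D m"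
        using x y \<open>\<And>n. A \<inter> good \<subseteq> D n\<close> by blast+
      then have "n = m"
        using disj[of n m] eq by blast
      then show "n = m \<and> x = y"
        using xy eq inj_onD[OF f(2)] by blast
    qed
  qed
  define \<Z> where "\<Z> = insert good
    ((\<lambda>(n, hs). W n \<inter> clique_zone A hs) ` (SIGMA n:UNIV. {hs \<in> lists (carrier G). length hs = 2 * n + 2}))"
  have "countable \<Z>"
    unfolding \<Z>_def using countable_carrier
    by (intro countable_insert countable_image countable_SIGMA)
      (auto intro: countable_subset[OF _ countable_lists])
  \<comment> \<open>Containing \<open>good\<close>, the family \<open>\<Z>\<close> is nonempty, as
    the enumeration requires.\<close>
  define Z where "Z = from_nat_into \<Z>"
  have Z: "range Z = \<Z>"
    unfolding Z_def using \<open>countable \<Z>\<close> by (intro range_from_nat_into) (auto simp: \<Z>_def)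
  have zone: "invariant V \<and> infinitely_embeds A V" if "V \<in> \<Z>" for V
  proof (cases "V = good")
    case False
    with that obtain n hs where V: "V = W n \<inter> clique_zone A hs"
      and hs: "set hs \<subseteq> carrier G" "length hs = 2 * n + 2"
      unfolding \<Z>_def by auto
    have inv: "invariant V"
      unfolding V using W invariant_clique_zone[OF A hs(1)] by (rule invariant_Int)
    have "V \<subseteq> (\<Union>i\<le>n. f i ` D i)"
      unfolding V W_def saturation_def using maximal by blast
    moreover have "V \<subseteq> clique_zone A hs"
      unfolding V by (rule Int_lower2)
    ultimately have "infinitely_embeds A V"
      by (intro infinitely_embeds_exhausted[OF A D f hs inv])
    with inv show ?thesis by blast
  qed (use good good_emb in simp)
  have "\<Omega> = \<Union> \<Z>"
  proof
    show "\<Union> \<Z> \<subseteq> \<Omega>"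
      using zone sets_into_space unfolding invariant_def by blast
    show "\<Omega> \<subseteq> \<Union> \<Z>"
    proof
      fix x assume x: "x \<in> \<Omega>"
      show "x \<in> \<Union> \<Z>"
      proof (cases "x \<in> good")
        case True
        then show ?thesis by (auto simp: \<Z>_def)
      next
        case False
        then obtain n where "x \<in> W n"
          using x by (auto simp: good_def)
        moreover obtain hs where "set hs \<subseteq> carrier G" "length hs = 2 * n + 2" "x \<in> clique_zone A hs"
          using clique[OF x] by blast
        ultimately show ?thesis
          unfolding \<Z>_def by fastforce
      qed
    qed
  qed
  then show ?thesis
    using infinitely_embeds_glue[OF A, of Z] zone Z by (metis rangeI)
qed

end

section \<open>Generated \<sigma>-algebras and their invariance\<close>

text \<open>The embeddings are found over the smallest \<sigma>-algebra and then read over larger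
  ones; the same pieces serve.\<close>

lemma piecewise_mono:
  assumes "invariant_sigma_algebra G \<Omega> \<phi> \<C>" "invariant_sigma_algebra G \<Omega> \<phi> \<D>" "\<C> \<subseteq> \<D>"
    and "invariant_sigma_algebra.piecewise G \<phi> \<C> f D"
  shows "invariant_sigma_algebra.piecewise G \<phi> \<D> f D"
  using assms(3,4) unfolding assms(1,2)[THEN invariant_sigma_algebra.piecewise_def] by blast

text \<open>Translation is a bijection of the space, so it commutes with complements and countable
  unions, and invariance spreads from the generators.\<close>

lemma invariant_sigma_algebra_sigma_sets:
  fixes G (structure)
  assumes action: "group_action G \<Omega> \<phi>" and countable_G: "countable (carrier G)"
    and gen: "\<E> \<subseteq> Pow \<Omega>"
      "\<And>g S. \<lbrakk>g \<in> carrier G; S \<in> \<E>\<rbrakk> \<Longrightarrow> \<phi> g ` S \<in> sigma_sets \<Omega> \<E>"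
  shows "invariant_sigma_algebra G \<Omega> \<phi> (sigma_sets \<Omega> \<E>)"
proof -
  interpret group_action G \<Omega> \<phi> by (rule action)
  interpret sigma_algebra \<Omega> "sigma_sets \<Omega> \<E>"
    by (rule sigma_algebra_sigma_sets[OF gen(1)])
  show ?thesis
  proof unfold_locales
    fix g S assume g: "g \<in> carrier G" and "S \<in> sigma_sets \<Omega> \<E>"
    from this(2) show "\<phi> g ` S \<in> sigma_sets \<Omega> \<E>"
    proof induction
      case (Basic S)
      then show ?case using gen(2) g by blast
    next
      case (Compl S)
      then have "\<phi> g ` (\<Omega> - S) = \<Omega> - \<phi> g ` S"
        using inj_on_image_set_diff[OF inj_prop[OF g], of \<Omega> S] surj_prop[OF g]
          sigma_sets_into_sp[OF gen(1)] by auto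
      then show ?case using Compl by (simp add: sigma_sets.Compl)
    next
      case (Union S)
      then show ?case by (simp add: image_UN sigma_sets.Union)
    qed (simp add: sigma_sets.Empty)
  qed (rule countable_G)
qed

lemma translates_translate:
  fixes G (structure)
  assumes "group_action G \<Omega> \<phi>" and "\<And>i. i \<in> I \<Longrightarrow> S i \<subseteq> \<Omega>"
    and "g \<in> carrier G" "T \<in> {\<phi> h ` S i | h i. h \<in> carrier G \<and> i \<in> I}"
  shows "\<phi> g ` T \<in> {\<phi> h ` S i | h i. h \<in> carrier G \<and> i \<in> I}"
proof -
  interpret group_action G \<Omega> \<phi> by fact
  from assms(4) obtain h i where h: "h \<in> carrier G" "i \<in> I" "T = \<phi> h ` S i" by blast
  have "\<phi> g ` T = \<phi> (g \<otimes> h) ` S i"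
    unfolding h(3) image_image
    using composition_rule assms(2,3) h by (intro image_cong) (auto simp: subset_iff)
  then show ?thesis
    using assms(3) h by blast
qed

lemma invariant_sigma_algebra_translates:
  fixes G (structure)
  assumes "group_action G \<Omega> \<phi>" "countable (carrier G)" "\<And>i. i \<in> I \<Longrightarrow> S i \<subseteq> \<Omega>"
  shows "invariant_sigma_algebra G \<Omega> \<phi>
    (sigma_sets \<Omega> {\<phi> h ` S i | h i. h \<in> carrier G \<and> i \<in> I})"
proof (rule invariant_sigma_algebra_sigma_sets[OF assms(1,2)])
  interpret group_action G \<Omega> \<phi> by fact
  let ?T = "{\<phi> h ` S i | h i. h \<in> carrier G \<and> i \<in> I}"
  show "?T \<subseteq> Pow \<Omega>"
    using assms(3) by (auto simp: subset_iff)
  show "\<phi> g ` T \<in> sigma_sets \<Omega> ?T" if "g \<in> carrier G" "T \<in> ?T" for g T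
    using translates_translate[OF assms(1,3) that] by (rule sigma_sets.Basic)
qed

lemma invariant_sigma_algebra_borel:
  fixes G (structure)
  assumes "countable (carrier G)" "borel_G_space G X \<phi>"
  shows "invariant_sigma_algebra G (space X) \<phi> (sets X)"
proof -
  interpret group_action G "space X" \<phi>
    using assms(2) by (simp add: borel_G_space_def)
  show ?thesis
  proof unfold_locales
    fix g S assume g: "g \<in> carrier G" and S: "S \<in> sets X"
    have "(\<lambda>(g, x). \<phi> g x) \<in> count_space (carrier G) \<Otimes>\<^sub>M X \<rightarrow>\<^sub>M X"
      using assms(2) by (simp add: borel_G_space_def)
    from measurable_compose[OF measurable_Pair1'[of "inv g"] this]
    have "\<phi> (inv g) \<in> X \<rightarrow>\<^sub>M X"
      using g by simp
    from measurable_sets[OF this S] show "\<phi> g ` S \<in> sets X"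
      unfolding translate_eq_vimage[OF g sets.sets_into_space[OF S]]
      by (simp add: vimage_def Int_def conj_commute)
  qed (rule assms(1))
qed

text \<open>A countable base generates the Borel sets, since every open set is the union of the base
  sets inside it.\<close>

lemma standard_borel_countably_generated:
  fixes M :: "'a measure"
  assumes "standard_borel M"
  obtains U :: "nat \<Rightarrow> 'a set" where "range U \<subseteq> Pow (space M)" "sets M = sigma_sets (space M) (range U)"
proof -
  from assms obtain T where T: "second_countable T" "topspace T = space M"
    and sets: "sets M = sigma_sets (space M) {U. openin T U}"
    unfolding standard_borel_def by blast
  from T(1) obtain \<B> where \<B>: "countable \<B>" "\<And>V. V \<in> \<B> \<Longrightarrow> openin T V"
    "\<And>U x. openin T U \<Longrightarrow> x \<in> U \<Longrightarrow> \<exists>V\<in>\<B>. x \<in> V \<and> V \<subseteq> U"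
    unfolding second_countable_def by metis
  \<comment> \<open>A base of the empty space may be empty, and the enumeration needs a nonempty
    set; hence \<open>{}\<close> is added.\<close>
  define U where "U = from_nat_into (insert {} \<B>)"
  have range: "range U = insert {} \<B>"
    unfolding U_def using \<B>(1) by (intro range_from_nat_into) auto
  have open_U: "openin T V" if "V \<in> insert {} \<B>" for V
    using that \<B>(2) by auto
  show thesis
  proof
    show *: "range U \<subseteq> Pow (space M)"
      unfolding range using open_U openin_subset T(2) by blast
    interpret sigma_algebra "space M" "sigma_sets (space M) (range U)"
      by (rule sigma_algebra_sigma_sets[OF *])
    show "sets M = sigma_sets (space M) (range U)"
      unfolding sets
    proof (rule sigma_sets_eqI)
      fix V assume "V \<in> {U. openin T U}"
      then have "V = \<Union> {W \<in> \<B>. W \<subseteq> V}"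
        using \<B>(3) by blast
      moreover have "\<Union> {W \<in> \<B>. W \<subseteq> V} \<in> sigma_sets (space M) (range U)"
      proof (rule countable_Union)
        show "countable {W \<in> \<B>. W \<subseteq> V}"
          using \<B>(1) by (rule countable_subset[rotated]) blast
        show "{W \<in> \<B>. W \<subseteq> V} \<subseteq> sigma_sets (space M) (range U)"
          unfolding range by (auto intro: sigma_sets.Basic)
      qed
      ultimately show "V \<in> sigma_sets (space M) (range U)" by simp
    next
      fix V assume "V \<in> range U"
      then show "V \<in> sigma_sets (space M) {U. openin T U}"
        using range open_U by (intro sigma_sets.Basic) blast
    qed
  qed
qed

text \<open>Only finitely many of the translating elements are kept, because the finite lists over a
  countable group can be enumerated.\<close>

lemma weakly_wandering_clique:
  assumes "weakly_wandering G M \<phi> A"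
  obtains hs where "set hs \<subseteq> carrier G" "length hs = k"
    "\<And>i j. \<lbrakk>i < length hs; j < length hs; i \<noteq> j\<rbrakk> \<Longrightarrow> \<phi> (hs ! i) ` A \<inter> \<phi> (hs ! j) ` A = {}"
proof -
  from assms obtain H where H: "H \<subseteq> carrier G" "infinite H"
    "\<forall>h\<in>H. \<forall>h'\<in>H. h \<noteq> h' \<longrightarrow> \<phi> h ` A \<inter> \<phi> h' ` A = {}"
    unfolding weakly_wandering_def by blast
  obtain F where F: "finite F" "card F = k" "F \<subseteq> H"
    using infinite_arbitrarily_large[OF H(2)] by blast
  obtain hs where hs: "set hs = F" "distinct hs"
    using finite_distinct_list[OF F(1)] by blast
  show thesis
  proof
    show "set hs \<subseteq> carrier G" "length hs = k"
      using hs F H(1) distinct_card[of hs] by auto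
    show "\<phi> (hs ! i) ` A \<inter> \<phi> (hs ! j) ` A = {}"
      if "i < length hs" "j < length hs" "i \<noteq> j" for i j
    proof -
      have "hs ! i \<in> H" "hs ! j \<in> H" "hs ! i \<noteq> hs ! j"
        using that hs F(3) nth_mem by (auto simp: nth_eq_iff_index_eq)
      then show ?thesis using H(3) by blast
    qed
  qed
qed

section \<open>The generator with four pieces\<close>

theorem theorem7p5:
  fixes G :: "('g, 'b) monoid_scheme" and X :: "'a measure" and \<phi> :: "'g \<Rightarrow> 'a \<Rightarrow> 'a"
  assumes "group G" and "countable (carrier G)" and "infinite (carrier G)"
    and "borel_G_space G X \<phi>"
    and "\<exists>A \<in> sets X. complete_section G X \<phi> A \<and> locally_weakly_wandering G X \<phi> A"
  shows "\<exists>P. borel_generator G X \<phi> 4 P"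
proof -
  obtain A where A: "A \<in> sets X" "complete_section G X \<phi> A" "locally_weakly_wandering G X \<phi> A"
    using assms(5) by blast
  have A_sub: "A \<subseteq> space X"
    using A(2) by (simp add: complete_section_def)
  interpret X: invariant_sigma_algebra G "space X" \<phi> "sets X"
    using assms(2,4) by (rule invariant_sigma_algebra_borel)
  have action: "group_action G (space X) \<phi>" ..

  \<comment> \<open>The embeddings are sought with pieces in \<open>\<C>\<close>, not merely Borel,
    so that the pieces can be recovered from \<open>A\<close> alone when \<open>B\<close> is
    decoded. The index set \<open>{()}\<close> presents the single set \<open>A\<close> as a
    family.\<close>
  define \<C> where "\<C> = sigma_sets (space X) {\<phi> h ` A | h i. h \<in> carrier G \<and> i \<in> {()}}"
  interpret C: invariant_sigma_algebra G "space X" \<phi> \<C>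
    unfolding \<C>_def by (rule invariant_sigma_algebra_translates[OF action assms(2)]) (rule A_sub)
  have translates_A: "\<C> \<subseteq> \<D>" if "invariant_sigma_algebra G (space X) \<phi> \<D>" "A \<in> \<D>" for \<D>
  proof -
    interpret D: invariant_sigma_algebra G "space X" \<phi> \<D> by fact
    show ?thesis
      unfolding \<C>_def using D.translate that(2) by (intro D.sigma_sets_subset) auto
  qed
  have "\<phi> \<one>\<^bsub>G\<^esub> ` A = A"
    using A_sub by (force simp: subset_iff)
  then have A_C: "A \<in> \<C>"
    unfolding \<C>_def by (intro sigma_sets.Basic CollectI exI[of _ "\<one>\<^bsub>G\<^esub>"] exI[of _ "()"]) simp
  have "C.infinitely_embeds A (space X)"
  proof (rule C.infinitely_embeds_of_cliques[OF A_C])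
    fix x k assume x: "x \<in> space X"
    then have "weakly_wandering G X \<phi> (A \<inter> orbit G \<phi> x)"
      using A(3) by (simp add: locally_weakly_wandering_def)
    then show "\<exists>hs. set hs \<subseteq> carrier G \<and> length hs = k \<and> x \<in> C.clique_zone A hs"
    proof (rule weakly_wandering_clique[where k = k])
      fix hs assume hs: "set hs \<subseteq> carrier G" "length hs = k"
        "\<And>i j. \<lbrakk>i < length hs; j < length hs; i \<noteq> j\<rbrakk> \<Longrightarrow>
          \<phi> (hs ! i) ` (A \<inter> orbit G \<phi> x) \<inter> \<phi> (hs ! j) ` (A \<inter> orbit G \<phi> x) = {}"
      then have "x \<in> C.clique_zone A hs"
        by (intro C.clique_zoneI[OF A_sub x])
      with hs(1,2) show ?thesis by blast
    qed
  qed
  then obtain f :: "nat \<Rightarrow> 'a \<Rightarrow> 'a" where f: "\<And>n. C.piecewise (f n) A"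
    and inj: "inj_on (\<lambda>(n, x). f n x) (UNIV \<times> A)"
    unfolding C.infinitely_embeds_def using A_sub by (auto simp: Int_absorb2)

  obtain U :: "nat \<Rightarrow> 'a set" where U: "range U \<subseteq> Pow (space X)"
    and sets_X: "sets X = sigma_sets (space X) (range U)"
    using assms(4) standard_borel_countably_generated[of X] unfolding borel_G_space_def by blast
  have U_sets: "U n \<in> sets X" for n
    unfolding sets_X by (rule sigma_sets.Basic) simp
  define B where "B = (\<Union>n. f n ` (A \<inter> U n))"
  have "X.piecewise (f n) A" for n
    using C.invariant_sigma_algebra_axioms X.invariant_sigma_algebra_axioms
      translates_A[OF X.invariant_sigma_algebra_axioms A(1)] f by (rule piecewise_mono)
  then have "X.piecewise (f n) (A \<inter> U n)" for n
    by (rule X.piecewise_restrict) (use A(1) U_sets in auto)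
  then have B: "B \<in> sets X"
    unfolding B_def by (intro sets.countable_UN) (auto intro: X.piecewise_image_sets)
  have B_sub: "B \<subseteq> space X"
    using B by (rule sets.sets_into_space)
  have decode: "A \<inter> U n = {x \<in> A. f n x \<in> B}" for n
  proof
    show "{x \<in> A. f n x \<in> B} \<subseteq> A \<inter> U n"
    proof
      fix x assume "x \<in> {x \<in> A. f n x \<in> B}"
      then obtain m y where "x \<in> A" "y \<in> A" "y \<in> U m" "f n x = f m y"
        unfolding B_def by blast
      \<comment> \<open>Injectivity on pairs gives \<open>m = n\<close> and
        \<open>y = x\<close>.\<close>
      then show "x \<in> A \<inter> U n"
        using inj_onD[OF inj, of "(n, x)" "(m, y)"] by auto
    qed
  qed (auto simp: B_def)

  \<comment> \<open>The two binary digits of \<open>n\<close> record membership: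
    \<open>n < 2\<close> means inside \<open>A\<close>, even \<open>n\<close> means inside
    \<open>B\<close>.\<close>
  define P where "P n = (if n < 2 then A else space X - A) \<inter> (if even n then B else space X - B)"
    for n :: nat
  have P_sets: "P n \<in> sets X" for n
    using A(1) B by (auto simp: P_def)
  have four: "{..<4} = {0, 1, 2, 3 :: nat}"
    by auto
  have P_Un: "A = P 0 \<union> P 1" "B = P 0 \<union> P 2"
    using A_sub B_sub by (auto simp: P_def)
  define \<S> where "\<S> = sigma_sets (space X) {\<phi> h ` P i | h i. h \<in> carrier G \<and> i \<in> {..<4}}"
  interpret S: invariant_sigma_algebra G "space X" \<phi> \<S>
    unfolding \<S>_def using sets.sets_into_space[OF P_sets]
    by (rule invariant_sigma_algebra_translates[OF action assms(2)])
  have "\<S> \<subseteq> sets X"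
    unfolding \<S>_def using X.translate P_sets by (intro sets.sigma_sets_subset) auto
  have "P n \<in> \<S>" if "n < 4" for n
  proof -
    have "\<phi> \<one>\<^bsub>G\<^esub> ` P n = P n"
      using sets.sets_into_space[OF P_sets, of n] by (force simp: subset_iff)
    then show ?thesis
      unfolding \<S>_def using that
      by (intro sigma_sets.Basic CollectI exI[of _ "\<one>\<^bsub>G\<^esub>"] exI[of _ n]) simp
  qed
  then have AB_S: "A \<in> \<S>" "B \<in> \<S>"
    by (subst P_Un; simp add: S.Un)+
  have "S.piecewise (f n) A" for n
    using C.invariant_sigma_algebra_axioms S.invariant_sigma_algebra_axioms
      translates_A[OF S.invariant_sigma_algebra_axioms AB_S(1)] f by (rule piecewise_mono)
  then have AU_S: "A \<inter> U n \<in> \<S>" for n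
    unfolding decode using AB_S(2) by (rule S.piecewise_vimage_sets)
  \<comment> \<open>Starting from the decoded sets \<open>A \<inter> U n\<close>, the induction
    takes complements relative to \<open>A\<close>.\<close>
  have A_Int: "A \<inter> S \<in> \<S>" if "S \<in> sets X" for S
    using that unfolding sets_X
  proof induction
    case (Compl S)
    have "A \<inter> (space X - S) = A - (A \<inter> S)"
      using A_sub by blast
    then show ?case using Compl AB_S(1) by auto
  next
    case (Union S)
    then show ?case unfolding Int_UN_distrib by (intro S.countable_UN'') auto
  qed (use AU_S in auto)
  have "sets X \<subseteq> \<S>"
  proof
    fix S assume S: "S \<in> sets X"
    \<comment> \<open>As \<open>A\<close> meets every orbit, each point of \<open>S\<close> can be
      moved into \<open>A\<close>. So \<open>S\<close> is a countable union of translates of Borel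
      subsets of \<open>A\<close>, which \<open>A_Int\<close> covers.\<close>
    have S_eq: "S = (\<Union>g\<in>carrier G. \<phi> g ` (A \<inter> \<phi> (inv\<^bsub>G\<^esub> g) ` S))"
    proof
      show "S \<subseteq> (\<Union>g\<in>carrier G. \<phi> g ` (A \<inter> \<phi> (inv\<^bsub>G\<^esub> g) ` S))"
      proof
        fix x assume "x \<in> S"
        then have x: "x \<in> space X"
          using sets.sets_into_space[OF S] by blast
        then obtain g where g: "g \<in> carrier G" "\<phi> g x \<in> A"
          using A(2) unfolding complete_section_def orbit_def by blast
        then have "\<phi> (inv\<^bsub>G\<^esub> g) (\<phi> g x) \<in> \<phi> (inv\<^bsub>G\<^esub> g) ` (A \<inter> \<phi> (inv\<^bsub>G\<^esub> (inv\<^bsub>G\<^esub> g)) ` S)"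
          using \<open>x \<in> S\<close> by (intro imageI) simp
        then show "x \<in> (\<Union>g\<in>carrier G. \<phi> g ` (A \<inter> \<phi> (inv\<^bsub>G\<^esub> g) ` S))"
          using x g(1) X.inv_closed[OF g(1)] by (metis UN_I X.action_inv_left)
      qed
      show "(\<Union>g\<in>carrier G. \<phi> g ` (A \<inter> \<phi> (inv\<^bsub>G\<^esub> g) ` S)) \<subseteq> S"
        using sets.sets_into_space[OF S] by (auto simp: subset_iff)
    qed
    have "\<phi> g ` (A \<inter> \<phi> (inv\<^bsub>G\<^esub> g) ` S) \<in> \<S>" if "g \<in> carrier G" for g
      using that S by (intro S.translate A_Int X.translate) auto
    then show "S \<in> \<S>"
      by (subst S_eq) (rule S.countable_UN''[OF assms(2)])
  qed
  with \<open>\<S> \<subseteq> sets X\<close> have "sets X = \<S>" by blast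
  moreover have "disjoint_family_on P {..<4}" "(\<Union>n<4. P n) = space X"
    using A_sub B_sub unfolding four disjoint_family_on_def by (auto simp: P_def)
  ultimately have "borel_generator G X \<phi> 4 P"
    unfolding borel_generator_def \<S>_def using P_sets by simp
  then show ?thesis by blast
qed

end
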